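(* Let $(G,* )$ be a groupoid and let $A:G\to\mathbb{R}$ be a function. Assume that there exist $n\in\mathbb{N}$ and functions $f_1,\dots,f_n:G\to\mathbb{R}$ such that $$A(x*y)=f_1(x)f_1(y)+\dots+f_n(x)f_n(y)$$ holds for all $x,y\in G$. Then $$A(x*y)^2\leq A(x*x)\,A(y*y)$$ for all $x,y\in G$.
   Context: A groupoid $(G,* )$ is a set $G$ together with a binary operation $*:G\times G\to G$ (a magma); no associativity, commutativity or other property is assumed. $A(u)^2$ denotes $(A(u))^2$. $\mathbb{N}$ denotes the set of positive integers. *)

theory Defs
  imports Complex_Main
begin

(* A groupoid in the sense of a magma: a carrier set closed under a binary operation.
   The carrier is not required to be nonempty. *)
definition groupoid :: "'a set \<Rightarrow> ('a \<Rightarrow> 'a \<Rightarrow> 'a) \<Rightarrow> bool" where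
  "groupoid G f \<longleftrightarrow> (\<forall>x\<in>G. \<forall>y\<in>G. f x y \<in> G)"

end

theory Submission
  imports Defs "HOL-Analysis.Convex"
begin

text \<open>
  The hypothesis presents \<open>A (x \<star> y)\<close> as the Euclidean inner product of the vectors
  \<open>(f 1 x, \<dots>, f n x)\<close> and \<open>(f 1 y, \<dots>, f n y)\<close>, so \<open>A (x \<star> x)\<close> and \<open>A (y \<star> y)\<close> are their
  squared lengths, and the claim is the Cauchy--Schwarz inequality for these two vectors.
\<close>

theorem theorem2p1:
  fixes G :: "'a set" and op :: "'a \<Rightarrow> 'a \<Rightarrow> 'a" (infixl "\<star>" 70)
    and A :: "'a \<Rightarrow> real"
  assumes "groupoid G (\<star>)"
    and "\<exists>n::nat. n \<ge> 1 \<and> (\<exists>f :: nat \<Rightarrow> 'a \<Rightarrow> real.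
           \<forall>x\<in>G. \<forall>y\<in>G. A (x \<star> y) = (\<Sum>i = 1..n. f i x * f i y))"
  shows "\<forall>x\<in>G. \<forall>y\<in>G. (A (x \<star> y))\<^sup>2 \<le> A (x \<star> x) * A (y \<star> y)"
proof (intro ballI)
  fix x y assume xy: "x \<in> G" "y \<in> G"
  obtain n :: nat and f :: "nat \<Rightarrow> 'a \<Rightarrow> real"
    where A: "\<And>u v. u \<in> G \<Longrightarrow> v \<in> G \<Longrightarrow> A (u \<star> v) = (\<Sum>i = 1..n. f i u * f i v)"
    using assms(2) by blast
  have "(\<Sum>i = 1..n. f i x * f i y)\<^sup>2 \<le> (\<Sum>i = 1..n. (f i x)\<^sup>2) * (\<Sum>i = 1..n. (f i y)\<^sup>2)"
    by (rule Cauchy_Schwarz_ineq_sum)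
  then show "(A (x \<star> y))\<^sup>2 \<le> A (x \<star> x) * A (y \<star> y)"
    using xy by (simp add: A power2_eq_square)
qed

end
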